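(* Let $n\ge 2$ and let $P$ be a regular and transitive game on $n$ players. Let $0<\alpha<\frac{2}{n(n-1)}$, let $x_\alpha$ be the unique positive root of $x\mapsto 2\,\mathrm{arctanh}^3(x)-3\alpha x$, and put $P_{max}:=\max_{i,j}P_{ij}$ and $P_{min}:=\min_{(i,j):\,P_{ij}>0}P_{ij}$. (1) If $$P_{max}<\frac{x_\alpha}{n-1}\qquad\text{and}\qquad \frac{P_{max}}{P_{min}}<\frac{n}{n-2+n(n-1)\alpha},$$ then $P\sim \mathrm{Elo}(P)$. (2) In particular, for $\beta>0$ let $\varphi_\beta(x):=\frac1\beta\tanh(\beta x)$, and let $\beta_\alpha>0$ be such that $$\frac{\tanh(\beta_\alpha P_{max})}{\tanh(\beta_\alpha P_{min})}\le \frac{n}{n-2+n(n-1)\alpha};$$ for example, $\beta_\alpha=\frac{1}{P_{min}}\mathrm{arctanh}\left(\frac{n-2}{n}+(n-1)\alpha\right)$ satisfies this. Then, for every $\beta>\max\left(\frac{n-1}{x_\alpha},\beta_\alpha\right)$, $$P\sim\varphi_\beta(P)\sim \mathrm{Elo}(\varphi_\beta(P)),$$ and, setting $\widehat P:=\varphi_\beta^{-1}(\mathrm{Elo}(\varphi_\beta(P)))$, one has $P\sim\widehat P$.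
   Context: A game on $n$ players is an antisymmetric real $n\times n$ matrix $P$ ($P=-P^T$) with entries in $[-1,1]$. Put $\widetilde P_{ij}:=\frac{1+P_{ij}}{2}\in[0,1]$ (the probability that player $i$ beats player $j$). $P$ is regular if $P_{ij}\neq0$ for all $i\ne j$. $P$ is transitive if, for all $i,j,k$, $P_{ij}>0$ and $P_{jk}>0$ imply $P_{ik}>0$. For antisymmetric matrices $P,Q$ of the same size, $P\sim Q$ means that $P_{ij}>0\Leftrightarrow Q_{ij}>0$ for all $i,j$. Let $\sigma(x)=(1+e^{-x})^{-1}$ and $\mathrm{bce}(y,\hat y):=-y\ln\hat y-(1-y)\ln(1-\hat y)$. The Elo rating $\varepsilon^P=(\varepsilon^P_i)_{i=1}^n\in\mathbb R^n$ of a game $P$ is a minimizer over $\varepsilon\in\mathbb R^n$ of $\sum_{i,j}\mathrm{bce}\left(\widetilde P_{ij},\sigma(\varepsilon_i-\varepsilon_j)\right)$, and $\mathrm{Elo}(P)$ is the game with entries $\mathrm{Elo}(P)_{ij}:=2\sigma(\varepsilon^P_i-\varepsilon^P_j)-1$. A real function applied to a matrix is applied entrywise. For $\varphi_\beta(x)=\frac1\beta\tanh(\beta x)$, the inverse is $\varphi_\beta^{-1}(x)=\frac1\beta\mathrm{arctanh}(\beta x)$, with the convention $\varphi_\beta^{-1}(x):=1$ for $x\ge\varphi_\beta(1)$ and $\varphi_\beta^{-1}(x):=-1$ for $x\le-\varphi_\beta(1)$, so that $\widehat P$ has entries in $[-1,1]$. *)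

theory Defs
  imports "HOL-Analysis.Analysis"
begin

definition is_game :: "real^'n^'n \<Rightarrow> bool" where
  "is_game P \<longleftrightarrow> P = - transpose P \<and> (\<forall>i j. P $ i $ j \<in> {-1..1})"

definition regular_game :: "real^'n^'n \<Rightarrow> bool" where
  "regular_game P \<longleftrightarrow> (\<forall>i j. i \<noteq> j \<longrightarrow> P $ i $ j \<noteq> 0)"

definition transitive_game :: "real^'n^'n \<Rightarrow> bool" where
  "transitive_game P \<longleftrightarrow> (\<forall>i j k. P $ i $ j > 0 \<and> P $ j $ k > 0 \<longrightarrow> P $ i $ k > 0)"

definition game_equiv :: "real^'n^'n \<Rightarrow> real^'n^'n \<Rightarrow> bool" (infix \<open>\<sim>\<^sub>G\<close> 50) where
  "P \<sim>\<^sub>G Q \<longleftrightarrow> (\<forall>i j. P $ i $ j > 0 \<longleftrightarrow> Q $ i $ j > 0)"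

definition win_prob :: "real^'n^'n \<Rightarrow> real^'n^'n" where
  "win_prob P = map_matrix (\<lambda>x. (1 + x) / 2) P"

definition sigmoid :: "real \<Rightarrow> real" where
  "sigmoid x = inverse (1 + exp (- x))"

definition bce :: "real \<Rightarrow> real \<Rightarrow> real" where
  "bce y y' = - y * ln y' - (1 - y) * ln (1 - y')"

definition elo_loss :: "real^'n^'n \<Rightarrow> real^'n \<Rightarrow> real" where
  "elo_loss P e = (\<Sum>i\<in>UNIV. \<Sum>j\<in>UNIV. bce (win_prob P $ i $ j) (sigmoid (e $ i - e $ j)))"

text \<open>Minimizers of the loss are unique only up to adding a constant to all ratings, so a
  minimizer is chosen; \<open>Elo\<close> below depends on rating differences only. If there is no
  minimizer (possible only if some off-diagonal entry is 1 or -1), the value is arbitrary.\<close>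

definition elo_rating :: "real^'n^'n \<Rightarrow> real^'n" where
  "elo_rating P = (ARG_MIN (elo_loss P) e. True)"

definition Elo :: "real^'n^'n \<Rightarrow> real^'n^'n" where
  "Elo P = (\<chi> i j. 2 * sigmoid (elo_rating P $ i - elo_rating P $ j) - 1)"

definition P_max :: "real^'n^'n \<Rightarrow> real" where
  "P_max P = Max {P $ i $ j | i j. True}"

definition P_min :: "real^'n^'n \<Rightarrow> real" where
  "P_min P = Min {P $ i $ j | i j. P $ i $ j > 0}"

text \<open>The bound \<open>x < 1\<close> restricts to the domain of the inverse hyperbolic tangent, which is
  a total function in the library.\<close>

definition x_root :: "real \<Rightarrow> real" where
  "x_root \<alpha> = (THE x. 0 < x \<and> x < 1 \<and> 2 * artanh x ^ 3 - 3 * \<alpha> * x = 0)"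

definition phi :: "real \<Rightarrow> real \<Rightarrow> real" where
  "phi \<beta> x = 1 / \<beta> * tanh (\<beta> * x)"

definition phi_inv :: "real \<Rightarrow> real \<Rightarrow> real" where
  "phi_inv \<beta> x =
     (if x \<ge> phi \<beta> 1 then 1
      else if x \<le> - phi \<beta> 1 then -1
      else 1 / \<beta> * artanh (\<beta> * x))"

end

theory Submission
  imports Defs
begin

text \<open>
  A minimizer of the Elo loss exists as soon as all entries of the game lie strictly between
  \<open>-1\<close> and \<open>1\<close>, and stationarity says that the Elo game has the same row sums as \<open>P\<close>. Since the
  row sums of the Elo game increase strictly with the rating, the ratings order the players by
  the row sums of \<open>P\<close>. If \<open>i\<close> beats \<open>j\<close>, transitivity bounds the difference of the two row
  sums below by \<open>n P_min - (n - 2) P_max\<close>, which is positive under the ratio hypothesis. Of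
  \<open>x_\<alpha>\<close> only \<open>0 < x_\<alpha> < 1\<close> matters. For \<open>\<phi>_\<beta>(P)\<close> the ratio hypothesis holds because
  \<open>tanh (\<beta> a) / tanh (\<beta> b)\<close> is nonincreasing in \<open>\<beta>\<close> whenever \<open>a \<ge> b > 0\<close>.
\<close>

section \<open>Antisymmetry, the sigmoid and the cross-entropy\<close>

lemma is_gameD:
  assumes "is_game P"
  shows "P $ j $ i = - P $ i $ j" "P $ i $ i = 0" "P $ i $ j \<le> 1" "- 1 \<le> P $ i $ j"
proof -
  have anti: "P $ j $ i = - P $ i $ j" for i j
  proof -
    have "P $ j $ i = (- transpose P) $ j $ i" using assms unfolding is_game_def by metis
    also have "\<dots> = - P $ i $ j" by (simp add: transpose_def)
    finally show ?thesis .
  qed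
  then show "P $ j $ i = - P $ i $ j" .
  from anti[of i i] show "P $ i $ i = 0" by simp
  show "P $ i $ j \<le> 1" "- 1 \<le> P $ i $ j"
    using assms unfolding is_game_def by auto
qed

lemma one_minus_sigmoid: "1 - sigmoid x = sigmoid (- x)"
proof -
  have "1 + exp x > 0" "1 + exp (-x) > 0" by (simp_all add: add_pos_pos)
  then show ?thesis unfolding sigmoid_def by (simp add: exp_minus field_simps)
qed

lemma sigmoid_less_iff [simp]: "sigmoid x < sigmoid y \<longleftrightarrow> x < y"
proof -
  have "sigmoid x < sigmoid y \<longleftrightarrow> 1 + exp (- y) < 1 + exp (- x)"
    unfolding sigmoid_def by (intro inverse_less_iff_less) (simp_all add: add_pos_pos)
  then show ?thesis by simp
qed

lemma sigmoid_0: "sigmoid 0 = 1 / 2"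
  by (simp add: sigmoid_def)

lemma bce_sigmoid: "bce p (sigmoid x) = p * ln (1 + exp (- x)) + (1 - p) * ln (1 + exp x)"
  unfolding bce_def one_minus_sigmoid by (simp add: sigmoid_def ln_inverse add_pos_pos algebra_simps)

text \<open>Both logarithms in \<open>bce_sigmoid\<close> are nonnegative and one of them is at
  least \<open>\<bar>x\<bar>\<close>, so weights of at least \<open>c\<close> give linear growth in
  both directions. This is the source of coercivity.\<close>

lemma bce_sigmoid_ge:
  assumes "c \<le> p" "c \<le> 1 - p" "0 \<le> c"
  shows "c * \<bar>x\<bar> \<le> bce p (sigmoid x)"
proof -
  have nonneg: "0 \<le> ln (1 + exp y)" for y :: real by (intro ln_ge_zero) simp
  have ge: "y \<le> ln (1 + exp y)" for y :: real
    by (subst ln_ge_iff) (simp_all add: add_pos_pos)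
  have "\<bar>x\<bar> \<le> ln (1 + exp (- x)) + ln (1 + exp x)"
    using ge[of x] ge[of "-x"] nonneg[of x] nonneg[of "-x"] by linarith
  then have "c * \<bar>x\<bar> \<le> c * (ln (1 + exp (- x)) + ln (1 + exp x))"
    using assms by (intro mult_left_mono)
  also have "\<dots> \<le> bce p (sigmoid x)"
    unfolding bce_sigmoid distrib_left by (intro add_mono mult_right_mono) (use assms nonneg in auto)
  finally show ?thesis .
qed

lemma has_real_derivative_bce_sigmoid:
  "((\<lambda>x. bce p (sigmoid x)) has_real_derivative (sigmoid x - p)) (at x)"
proof -
  have pos: "1 + exp x > 0" "1 + exp (-x) > 0" by (simp_all add: add_pos_pos)
  have "((\<lambda>x. p * ln (1 + exp (- x)) + (1 - p) * ln (1 + exp x)) has_real_derivative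
      p * (- exp (- x) / (1 + exp (- x))) + (1 - p) * (exp x / (1 + exp x))) (at x)"
    using pos by (auto intro!: derivative_eq_intros simp: mult.commute)
  moreover have "exp x / (1 + exp x) = sigmoid x"
    using pos by (simp add: sigmoid_def exp_minus field_simps)
  moreover have "- exp (- x) / (1 + exp (- x)) = sigmoid x - 1"
    using pos by (simp add: sigmoid_def exp_minus field_simps)
  moreover have "p * (sigmoid x - 1) + (1 - p) * sigmoid x = sigmoid x - p"
    by (simp add: algebra_simps)
  ultimately show ?thesis unfolding bce_sigmoid by (simp only:)
qed

section \<open>Existence and stationarity of Elo minimizers\<close>

lemma elo_loss_translate: "elo_loss P (e + (\<chi> i. c)) = elo_loss P e"
  by (simp add: elo_loss_def)

lemma continuous_on_elo_loss: "continuous_on S (elo_loss P)"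
proof -
  have "1 + exp x \<noteq> 0" for x :: real by (metis add_pos_pos exp_gt_zero less_irrefl zero_less_one)
  then show ?thesis
    unfolding elo_loss_def bce_sigmoid by (intro continuous_intros) auto
qed

text \<open>Modulo translations the loss is coercive, so a minimum over a large box is global.\<close>

lemma elo_loss_attains_min:
  fixes P :: "real^'n^'n"
  assumes "\<And>i j. \<bar>P $ i $ j\<bar> < 1"
  obtains e where "\<And>e'. elo_loss P e \<le> elo_loss P e'"
proof -
  \<comment> \<open>\<open>(1 - \<bar>P $ i $ j\<bar>) / 2\<close> is the smaller of the win
    probability and its complement, so \<open>c\<close> serves as weight for all pairs at
    once.\<close>
  define c where "c = Min (range (\<lambda>(i, j). (1 - \<bar>P $ i $ j\<bar>) / 2))"
  have c_le: "c \<le> (1 - \<bar>P $ i $ j\<bar>) / 2" for i j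
    unfolding c_def by (rule Min_le) (auto intro: rev_image_eqI[of "(i, j)"])
  have "c > 0"
    unfolding c_def using assms by (subst Min_gr_iff) auto
  have ge: "c * \<bar>x\<bar> \<le> bce (win_prob P $ i $ j) (sigmoid x)" for i j x
    using c_le[of i j] \<open>c > 0\<close> by (intro bce_sigmoid_ge) (auto simp: win_prob_def field_simps)
  have nonneg: "0 \<le> bce (win_prob P $ i $ j) (sigmoid x)" for i j x
    using order.trans[OF _ ge[of x i j]] \<open>c > 0\<close> by simp
  have coercive: "c * \<bar>e $ i - e $ j\<bar> \<le> elo_loss P e" for e i j
  proof -
    have "c * \<bar>e $ i - e $ j\<bar> \<le> bce (win_prob P $ i $ j) (sigmoid (e $ i - e $ j))" by (rule ge)
    also have "\<dots> \<le> (\<Sum>j\<in>UNIV. bce (win_prob P $ i $ j) (sigmoid (e $ i - e $ j)))"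
      using nonneg by (intro member_le_sum) auto
    also have "\<dots> \<le> elo_loss P e"
      unfolding elo_loss_def
      using nonneg by (intro member_le_sum[of i UNIV "\<lambda>i. \<Sum>j\<in>UNIV. bce (win_prob P $ i $ j) (sigmoid (e $ i - e $ j))"] sum_nonneg) auto
    finally show ?thesis .
  qed
  \<comment> \<open>Once two ratings differ by more than \<open>B\<close>, the coercive bound alone
    exceeds the loss at \<open>0\<close>.\<close>
  define B where "B = elo_loss P 0 / c"
  define K :: "(real^'n) set" where "K = cbox (\<chi> i. - B) (\<chi> i. B)"
  have K_iff: "e \<in> K \<longleftrightarrow> (\<forall>i. \<bar>e $ i\<bar> \<le> B)" for e
    unfolding K_def mem_box_cart by (auto simp: abs_le_iff minus_le_iff)
  have "B \<ge> 0"
    using coercive[of 0] \<open>c > 0\<close> unfolding B_def by simp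
  then have "0 \<in> K" by (simp add: K_iff)
  obtain e where e: "e \<in> K" "\<And>e'. e' \<in> K \<Longrightarrow> elo_loss P e \<le> elo_loss P e'"
    using continuous_attains_inf[of K "elo_loss P"] \<open>0 \<in> K\<close> continuous_on_elo_loss compact_cbox
    unfolding K_def by blast
  have "elo_loss P e \<le> elo_loss P e'" for e'
  proof -
    fix i0 :: 'n
    \<comment> \<open>Shifting the rating of \<open>i0\<close> to zero turns every coordinate into a
      rating difference. Outside the box some difference exceeds \<open>B\<close>, and then
      \<open>0\<close> already does at least as well as \<open>e0\<close>.\<close>
    define e0 where "e0 = e' + (\<chi> i. - e' $ i0)"
    have "elo_loss P e \<le> elo_loss P e0"
    proof (cases "e0 \<in> K")
      case False
      then obtain i where "B < \<bar>e0 $ i - e0 $ i0\<bar>"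
        unfolding K_iff e0_def by (auto simp: not_le)
      then have "elo_loss P 0 \<le> c * \<bar>e0 $ i - e0 $ i0\<bar>"
        using \<open>c > 0\<close> unfolding B_def by (simp add: field_simps)
      then show ?thesis using coercive[of e0 i i0] e(2)[OF \<open>0 \<in> K\<close>] by linarith
    qed (rule e(2))
    then show ?thesis unfolding e0_def elo_loss_translate .
  qed
  then show ?thesis by (rule that)
qed

text \<open>Move only the rating of \<open>k\<close>. Each pair contributes prediction minus target,
  \<open>a i j\<close>, times the change of the rating difference; since \<open>a\<close> is
  antisymmetric, row \<open>k\<close> and column \<open>k\<close> contribute equally, so the
  vanishing derivative is twice the row sum of \<open>a\<close> at \<open>k\<close>.\<close>

lemma elo_loss_stationary:
  fixes P :: "real^'n^'n"
  assumes "is_game P" and min: "\<And>e'. elo_loss P e \<le> elo_loss P e'"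
  shows "(\<Sum>j\<in>UNIV. sigmoid (e $ k - e $ j)) = (\<Sum>j\<in>UNIV. win_prob P $ k $ j)"
proof -
  define \<delta> where "\<delta> = (\<lambda>i. if i = k then 1 else 0 :: real)"
  define a where "a = (\<lambda>i j. sigmoid (e $ i - e $ j) - win_prob P $ i $ j)"
  have anti: "a j i = - a i j" for i j
    using one_minus_sigmoid[of "e $ i - e $ j"] is_gameD(1)[OF assms(1), of i j]
    unfolding a_def win_prob_def by (simp add: field_simps)
  define g where "g = (\<lambda>t. elo_loss P (e + t *\<^sub>R (\<chi> i. \<delta> i)))"
  have g_eq: "g = (\<lambda>t. \<Sum>i\<in>UNIV. \<Sum>j\<in>UNIV. bce (win_prob P $ i $ j) (sigmoid (e $ i - e $ j + t * (\<delta> i - \<delta> j))))"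
    unfolding g_def elo_loss_def by (simp add: algebra_simps)
  have "((\<lambda>t. bce (win_prob P $ i $ j) (sigmoid (e $ i - e $ j + t * (\<delta> i - \<delta> j))))
      has_real_derivative a i j * (\<delta> i - \<delta> j)) (at 0)" for i j
    unfolding a_def
    by (rule DERIV_chain2[where f = "\<lambda>x. bce (win_prob P $ i $ j) (sigmoid x)"])
      (auto intro!: derivative_eq_intros has_real_derivative_bce_sigmoid[THEN DERIV_cong])
  then have "(g has_real_derivative (\<Sum>i\<in>UNIV. \<Sum>j\<in>UNIV. a i j * (\<delta> i - \<delta> j))) (at 0)"
    unfolding g_eq by (intro DERIV_sum)
  then have "(\<Sum>i\<in>UNIV. \<Sum>j\<in>UNIV. a i j * (\<delta> i - \<delta> j)) = 0"
    by (rule DERIV_local_min[of _ _ _ 1]) (auto simp: g_def min)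
  also have "(\<Sum>i\<in>UNIV. \<Sum>j\<in>UNIV. a i j * (\<delta> i - \<delta> j)) =
      (\<Sum>i\<in>UNIV. \<Sum>j\<in>UNIV. a i j * \<delta> i) - (\<Sum>i\<in>UNIV. \<Sum>j\<in>UNIV. a i j * \<delta> j)"
    by (simp add: right_diff_distrib sum_subtractf)
  also have "(\<Sum>i\<in>UNIV. \<Sum>j\<in>UNIV. a i j * \<delta> i) = (\<Sum>j\<in>UNIV. a k j)"
    by (subst sum.swap) (simp add: \<delta>_def if_distrib cong: if_cong)
  also have "(\<Sum>i\<in>UNIV. \<Sum>j\<in>UNIV. a i j * \<delta> j) = - (\<Sum>j\<in>UNIV. a k j)"
    by (simp add: \<delta>_def if_distrib anti[of _ k] sum_negf cong: if_cong)
  finally show ?thesis by (simp add: a_def sum_subtractf)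
qed

lemma elo_rating_min:
  fixes P :: "real^'n^'n"
  assumes "\<And>i j. \<bar>P $ i $ j\<bar> < 1"
  shows "elo_loss P (elo_rating P) \<le> elo_loss P e"
proof -
  obtain e0 where "\<And>e'. elo_loss P e0 \<le> elo_loss P e'"
    using elo_loss_attains_min[of P, OF assms] by blast
  then have "is_arg_min (elo_loss P) (\<lambda>_. True) e0" by (simp add: is_arg_min_linorder)
  then have "is_arg_min (elo_loss P) (\<lambda>_. True) (elo_rating P)"
    unfolding elo_rating_def arg_min_def by (rule someI)
  then show ?thesis by (simp add: is_arg_min_linorder)
qed

section \<open>Elo order, row sums and the sign pattern of the game\<close>

text \<open>By stationarity one strictly increasing function \<open>S\<close>, the same for all
  players, sends each rating to an increasing affine function of the player's row sum.\<close>

lemma elo_rating_less_iff: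
  fixes P :: "real^'n^'n"
  assumes "is_game P" "\<And>i j. \<bar>P $ i $ j\<bar> < 1"
  shows "elo_rating P $ i < elo_rating P $ j \<longleftrightarrow> (\<Sum>k\<in>UNIV. P $ i $ k) < (\<Sum>k\<in>UNIV. P $ j $ k)"
proof -
  let ?e = "elo_rating P"
  define S where "S = (\<lambda>x. \<Sum>k\<in>UNIV. sigmoid (x - ?e $ k))"
  have S: "S (?e $ i) = (CARD('n) + (\<Sum>k\<in>UNIV. P $ i $ k)) / 2" for i
    using elo_loss_stationary[OF assms(1) elo_rating_min[OF assms(2)], of i]
    by (simp add: S_def win_prob_def sum.distrib flip: sum_divide_distrib)
  have less: "S x < S y" if "x < y" for x y
    unfolding S_def using that by (intro sum_strict_mono) auto
  have "x < y \<longleftrightarrow> S x < S y" for x y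
    using less[of x y] less[of y x] by (cases x y rule: linorder_cases) auto
  then have "?e $ i < ?e $ j \<longleftrightarrow> S (?e $ i) < S (?e $ j)" .
  then show ?thesis unfolding S by simp
qed

lemma Elo_pos_iff: "Elo P $ i $ j > 0 \<longleftrightarrow> elo_rating P $ j < elo_rating P $ i"
  using sigmoid_less_iff[of 0 "elo_rating P $ i - elo_rating P $ j"]
  unfolding sigmoid_0 Elo_def by (simp only: vec_lambda_beta) linarith

text \<open>The bounds \<open>m\<close> and \<open>M\<close> are left free so that the lemma also
  serves the transformed game, with the images of \<open>P_min P\<close> and \<open>P_max P\<close>
  under \<open>phi \<beta>\<close>.\<close>

lemma game_equiv_Elo:
  fixes P :: "real^'n^'n"
  assumes game: "is_game P" "regular_game P" "transitive_game P"
    and lt_1: "\<And>i j. \<bar>P $ i $ j\<bar> < 1"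
    and lower: "\<And>i j. P $ i $ j > 0 \<Longrightarrow> m \<le> P $ i $ j"
    and upper: "\<And>i j. P $ i $ j \<le> M"
    and "0 < m" and gap: "(real CARD('n) - 2) * M < real CARD('n) * m"
  shows "P \<sim>\<^sub>G Elo P"
proof -
  have anti: "P $ j $ i = - P $ i $ j" for i j by (rule is_gameD(1)[OF game(1)])
  have sums: "(\<Sum>k\<in>UNIV. P $ j $ k) < (\<Sum>k\<in>UNIV. P $ i $ k)" if ij: "P $ i $ j > 0" for i j
  proof -
    have "i \<noteq> j" using ij is_gameD(2)[OF game(1)] by auto
    \<comment> \<open>Transitivity rules out the bad case in which \<open>j\<close> beats
      \<open>k\<close> but \<open>i\<close> does not. If \<open>k\<close> beats both, the difference
      is \<open>P $ k $ j - P $ k $ i\<close>, again at least \<open>m - M\<close>.\<close>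
    have diff_ge: "m - M \<le> P $ i $ k - P $ j $ k" for k
    proof (cases "P $ j $ k > 0")
      case True
      then have "P $ i $ k > 0" using ij game(3) unfolding transitive_game_def by blast
      then show ?thesis using lower[of i k] upper[of j k] by linarith
    next
      case jk: False
      show ?thesis
      proof (cases "P $ i $ k > 0")
        case True
        then show ?thesis using lower[of i k] upper[of i k] jk by linarith
      next
        case ik: False
        consider "k = i" | "P $ k $ i > 0"
          using ik anti[of k i] game(2) unfolding regular_game_def by (metis less_eq_real_def neg_less_0_iff_less not_le)
        then show ?thesis
        proof cases
          case 1
          then show ?thesis using ij is_gameD(2)[OF game(1)] anti[of i j] lower[OF ij] upper[of i j] by simp
        next
          case 2
          then have "P $ k $ j > 0" using ij game(3) unfolding transitive_game_def by blast
          then show ?thesis using lower[of k j] upper[of k i] anti[of j k] anti[of i k] by simp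
        qed
      qed
    qed
    \<comment> \<open>Columns \<open>i\<close> and \<open>j\<close> each contribute exactly
      \<open>P $ i $ j\<close>, hence at least \<open>m\<close>; the other \<open>n - 2\<close>
      columns contribute at least \<open>m - M\<close> each. The fact from \<open>card_mono\<close>
      makes the natural subtraction \<open>n - 2\<close> exact.\<close>
    have "real CARD('n) * m - (real CARD('n) - 2) * M = (\<Sum>k\<in>UNIV - {i, j}. m - M) + 2 * m"
      using \<open>i \<noteq> j\<close> card_mono[of UNIV "{i, j}"] by (simp add: card_Diff_subset of_nat_diff algebra_simps)
    also have "\<dots> \<le> (\<Sum>k\<in>UNIV - {i, j}. P $ i $ k - P $ j $ k) + 2 * P $ i $ j"
      using diff_ge lower[OF ij] by (intro add_mono sum_mono) auto
    also have "\<dots> = (\<Sum>k\<in>UNIV. P $ i $ k - P $ j $ k)"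
      using \<open>i \<noteq> j\<close> anti[of i j] is_gameD(2)[OF game(1)]
      by (subst sum.subset_diff[of "{i, j}" UNIV]) auto
    finally show ?thesis using gap by (simp add: sum_subtractf)
  qed
  have "P $ i $ j > 0 \<longleftrightarrow> (\<Sum>k\<in>UNIV. P $ j $ k) < (\<Sum>k\<in>UNIV. P $ i $ k)" for i j
  \<comment> \<open>For the converse, regularity means that if \<open>i\<close> does not beat
    \<open>j \<noteq> i\<close>, then \<open>j\<close> beats \<open>i\<close> and the row sums are
    ordered the other way.\<close>
  proof (cases "i = j \<or> P $ i $ j > 0")
    case True
    then show ?thesis using sums[of i j] is_gameD(2)[OF game(1)] by auto
  next
    case False
    then have "P $ j $ i > 0"
      using game(2) anti[of i j] unfolding regular_game_def by (metis less_eq_real_def neg_0_less_iff_less not_le)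
    then show ?thesis using sums[of j i] False by auto
  qed
  then show ?thesis
    unfolding game_equiv_def Elo_pos_iff elo_rating_less_iff[OF game(1) lt_1] by blast
qed

section \<open>The inverse hyperbolic tangent and the root of the cubic equation\<close>

lemma tanh_artanh_real:
  fixes x :: real
  assumes "\<bar>x\<bar> < 1"
  shows "tanh (artanh x) = x"
proof -
  have "exp (- 2 * artanh x) = (1 - x) / (1 + x)"
    using assms unfolding artanh_def by (simp add: exp_minus)
  then show ?thesis using assms unfolding tanh_real_altdef by (simp only:) (simp add: divide_simps)
qed

lemma artanh_pos_iff:
  fixes x :: real
  assumes "\<bar>x\<bar> < 1"
  shows "artanh x > 0 \<longleftrightarrow> x > 0"
  using tanh_real_pos_iff[of "artanh x"] tanh_artanh_real[OF assms] by simp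

lemma artanh_less_iff:
  fixes x y :: real
  assumes "\<bar>x\<bar> < 1" "\<bar>y\<bar> < 1"
  shows "artanh x < artanh y \<longleftrightarrow> x < y"
  using tanh_real_less_iff[of "artanh x" "artanh y"] tanh_artanh_real assms by simp

lemma has_real_derivative_artanh_cubic:
  fixes x :: real
  assumes "\<bar>x\<bar> < 1"
  shows "((\<lambda>x. 2 * artanh x ^ 3 - 3 * \<alpha> * x) has_real_derivative
    6 * artanh x ^ 2 / (1 - x\<^sup>2) - 3 * \<alpha>) (at x)"
  using assms by (auto intro!: derivative_eq_intros simp: power2_eq_square)

text \<open>As \<open>x_root\<close> is a definite description, its bounds require both existence
  and uniqueness. The function \<open>g\<close> vanishes at \<open>0\<close>, is negative just to
  the right of it and nonnegative near \<open>1\<close>, so a root exists. Two roots in (0,1) would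
  give two zeros of \<open>g'\<close> by Rolle, but \<open>g'\<close> is strictly increasing
  there.\<close>

lemma x_root_bounds:
  assumes "\<alpha> > 0"
  shows "0 < x_root \<alpha>" "x_root \<alpha> < 1"
proof -
  define g where "g = (\<lambda>x::real. 2 * artanh x ^ 3 - 3 * \<alpha> * x)"
  define g' where "g' = (\<lambda>x::real. 6 * artanh x ^ 2 / (1 - x\<^sup>2) - 3 * \<alpha>)"
  have deriv: "(g has_real_derivative g' x) (at x)" if "\<bar>x\<bar> < 1" for x
    unfolding g_def g'_def by (rule has_real_derivative_artanh_cubic[OF that])
  have cont: "continuous_on {a..b} g" if "0 \<le> a" "b < 1" for a b
    using that by (intro DERIV_continuous_on[of _ _ g'] DERIV_subset[OF deriv]) auto
  have g0: "g 0 = 0" by (simp add: g_def artanh_def)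
  have g'_mono: "g' x < g' y" if "0 < x" "x < y" "y < 1" for x y
  proof -
    have "0 < artanh x" "artanh x < artanh y"
      using that by (simp_all add: artanh_pos_iff artanh_less_iff)
    then have "artanh x ^ 2 < artanh y ^ 2" by (intro power_strict_mono) auto
    moreover have "x\<^sup>2 < y\<^sup>2" "y\<^sup>2 < 1"
      using that power_strict_mono[of x y 2] power_strict_mono[of y 1 2] by auto
    ultimately show ?thesis
      unfolding g'_def by (intro diff_strict_right_mono frac_less) auto
  qed
  have rolle: "\<exists>z>a. z < b \<and> g' z = 0" if "0 \<le> a" "a < b" "b < 1" "g a = g b" for a b
  proof -
    have "g differentiable at z" if "a < z" "z < b" for z
      using deriv[of z] that \<open>0 \<le> a\<close> \<open>b < 1\<close> by (auto simp: real_differentiable_def)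
    then have "\<exists>z>a. z < b \<and> (g has_real_derivative 0) (at z)"
      by (intro Rolle that cont)
    then obtain z where z: "a < z" "z < b" "(g has_real_derivative 0) (at z)" by blast
    then show ?thesis using DERIV_unique[OF z(3) deriv[of z]] that by (intro exI[of _ z]) auto
  qed
  have no_two: False if "0 < x" "x < y" "y < 1" "g x = 0" "g y = 0" for x y
  proof -
    have "\<exists>z>0. z < x \<and> g' z = 0" "\<exists>z>x. z < y \<and> g' z = 0"
      using rolle[of 0 x] rolle[of x y] that g0 by auto
    then obtain z1 z2 where "0 < z1" "z1 < x" "g' z1 = 0" "x < z2" "z2 < y" "g' z2 = 0" by blast
    then show False using g'_mono[of z1 z2] that by auto
  qed
  \<comment> \<open>At \<open>tanh w\<close> the cubic term is \<open>2 * w ^ 3\<close>. Since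
    \<open>w \<ge> 1\<close>, this is at least \<open>2 * w\<close>, hence at least
    \<open>3 * \<alpha>\<close>, which dominates the linear term.\<close>
  define w where "w = max 1 (3 * \<alpha> / 2)"
  have w: "w \<ge> 1" "3 * \<alpha> \<le> 2 * w" unfolding w_def by auto
  have gw: "g (tanh w) \<ge> 0"
  proof -
    have "w ^ 1 \<le> w ^ 3" using w by (intro power_increasing) auto
    then have "3 * \<alpha> \<le> 2 * w ^ 3" using w by simp
    moreover have "3 * \<alpha> * tanh w \<le> 3 * \<alpha> * 1"
      using assms tanh_real_lt_1[of w] by (intro mult_left_mono) auto
    ultimately show ?thesis by (simp add: g_def artanh_tanh_real)
  qed
  obtain d where d: "d > 0" "\<And>h. 0 < h \<Longrightarrow> h < d \<Longrightarrow> g h < 0"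
    using DERIV_neg_dec_right[OF deriv[of 0]] assms g0 by (auto simp: g'_def artanh_def)
  \<comment> \<open>Halving keeps \<open>h\<close> strictly below both \<open>d\<close> and
    \<open>tanh w\<close>.\<close>
  define h where "h = min (d / 2) (tanh w / 2)"
  have "tanh w > 0" "tanh w < 1" using w by (simp_all add: tanh_real_lt_1)
  moreover have "h \<le> d / 2" "h \<le> tanh w / 2" "0 < h"
    using d(1) \<open>tanh w > 0\<close> unfolding h_def by simp_all
  ultimately have h: "0 < h" "h < tanh w" "g h < 0" using d by auto
  obtain x where x: "h \<le> x" "x \<le> tanh w" "g x = 0"
    using IVT'[of g h 0 "tanh w"] cont[of h "tanh w"] gw h \<open>tanh w < 1\<close> by force
  have "\<exists>!x. 0 < x \<and> x < 1 \<and> g x = 0"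
  proof (rule ex1I[of _ x])
    show x': "0 < x \<and> x < 1 \<and> g x = 0" using x h \<open>tanh w < 1\<close> by linarith
    show "y = x" if "0 < y \<and> y < 1 \<and> g y = 0" for y
      using no_two[of x y] no_two[of y x] that x' by (cases x y rule: linorder_cases) auto
  qed
  from theI'[OF this] show "0 < x_root \<alpha>" "x_root \<alpha> < 1" by (simp_all add: x_root_def g_def)
qed

section \<open>Monotonicity of a quotient of hyperbolic tangents\<close>

text \<open>The difference of the two sides vanishes at \<open>0\<close> and has derivative
  \<open>l * (cosh (l * t) - cosh t)\<close>, nonnegative because \<open>cosh\<close> increases on
  the nonnegative axis.\<close>

lemma sinh_superlinear:
  fixes l x :: real
  assumes "1 \<le> l" "0 \<le> x"
  shows "l * sinh x \<le> sinh (l * x)"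
proof -
  have "sinh (l * 0) - l * sinh 0 \<le> sinh (l * x) - l * sinh x"
  proof (rule DERIV_nonneg_imp_nondecreasing[OF \<open>0 \<le> x\<close>])
    fix t :: real assume "0 \<le> t"
    have "t \<le> l * t" using mult_right_mono[OF assms(1) \<open>0 \<le> t\<close>] by simp
    then have "0 \<le> l * cosh (l * t) - l * cosh t"
      using assms \<open>0 \<le> t\<close> by (simp add: cosh_real_nonneg_le_iff mult_left_mono)
    moreover have "((\<lambda>t. sinh (l * t) - l * sinh t) has_real_derivative l * cosh (l * t) - l * cosh t) (at t)"
      by (auto intro!: derivative_eq_intros)
    ultimately show "\<exists>y. ((\<lambda>t. sinh (l * t) - l * sinh t) has_real_derivative y) (at t) \<and> 0 \<le> y"
      by blast
  qed
  then show ?thesis by simp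
qed

text \<open>This carries the ratio bound from \<open>\<beta>\<^sub>\<alpha>\<close> to every larger
  \<open>\<beta>\<close>. Up to a positive factor the derivative in \<open>x\<close> is
  \<open>a * sinh (2 * x * b) - b * sinh (2 * x * a)\<close>, which superlinearity of
  \<open>sinh\<close> with factor \<open>a / b\<close> makes nonpositive.\<close>

lemma tanh_ratio_nonincreasing:
  fixes a b s t :: real
  assumes "0 < b" "b \<le> a" "0 < s" "s \<le> t"
  shows "tanh (t * a) / tanh (t * b) \<le> tanh (s * a) / tanh (s * b)"
proof (rule DERIV_nonpos_imp_nonincreasing[OF \<open>s \<le> t\<close>])
  fix x assume "s \<le> x"
  then have "x > 0" using assms by simp
  have pos: "sinh (x * b) > 0" "cosh (x * b) > 0" "cosh (x * a) > 0" "tanh (x * b) > 0"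
    using \<open>x > 0\<close> assms by (simp_all add: cosh_real_pos)
  have "a / b * sinh (2 * (x * b)) \<le> sinh (a / b * (2 * (x * b)))"
    using assms \<open>x > 0\<close> by (intro sinh_superlinear) auto
  then have sinh_le: "a * (sinh (x * b) * cosh (x * b)) \<le> b * (sinh (x * a) * cosh (x * a))"
    using assms sinh_double[of "x * a"] sinh_double[of "x * b"] by (simp add: field_simps)
  define D where "D = ((1 - tanh (x * a) ^ 2) * a * tanh (x * b) - tanh (x * a) * ((1 - tanh (x * b) ^ 2) * b)) / (tanh (x * b) * tanh (x * b))"
  have "((\<lambda>x. tanh (x * a) / tanh (x * b)) has_real_derivative D) (at x)"
    unfolding D_def using pos by (auto intro!: derivative_eq_intros)
  moreover have "D \<le> 0"
  proof -
    have sq: "1 - tanh y ^ 2 = 1 / cosh y ^ 2" for y :: real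
    proof -
      have "cosh y ^ 2 \<noteq> 0" using cosh_real_nonzero[of y] by simp
      then have "1 - tanh y ^ 2 = (cosh y ^ 2 - sinh y ^ 2) / cosh y ^ 2"
        by (simp add: tanh_def power_divide diff_divide_distrib)
      then show ?thesis by (simp add: cosh_square_eq)
    qed
    have "(1 - tanh (x * a) ^ 2) * a * tanh (x * b) - tanh (x * a) * ((1 - tanh (x * b) ^ 2) * b)
      = (a * (sinh (x * b) * cosh (x * b)) - b * (sinh (x * a) * cosh (x * a))) / (cosh (x * a) ^ 2 * cosh (x * b) ^ 2)"
      unfolding sq using pos unfolding tanh_def by (simp add: field_simps power2_eq_square)
    also have "\<dots> \<le> 0" using sinh_le by (intro divide_nonpos_nonneg) auto
    finally show ?thesis unfolding D_def by (intro divide_nonpos_nonneg) auto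
  qed
  ultimately show "\<exists>y. ((\<lambda>x. tanh (x * a) / tanh (x * b)) has_real_derivative y) (at x) \<and> y \<le> 0" by blast
qed

section \<open>The transformation \<open>phi\<close> and its clipped inverse\<close>

lemma phi_pos_iff: "\<beta> > 0 \<Longrightarrow> phi \<beta> x > 0 \<longleftrightarrow> x > 0"
  unfolding phi_def by (subst zero_less_mult_iff) (simp add: zero_less_mult_iff)

lemma phi_mono: "\<beta> > 0 \<Longrightarrow> x \<le> y \<Longrightarrow> phi \<beta> x \<le> phi \<beta> y"
  by (simp add: phi_def divide_right_mono mult_left_mono)

lemma abs_phi_less:
  assumes "\<beta> > 0"
  shows "\<bar>phi \<beta> x\<bar> < 1 / \<beta>"
proof -
  have "\<bar>tanh (\<beta> * x)\<bar> < 1"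
    using tanh_real_bounds[of "\<beta> * x"] by (auto simp: abs_less_iff)
  then show ?thesis using assms by (simp add: phi_def abs_mult divide_strict_right_mono)
qed

text \<open>Clipping preserves signs because \<open>phi \<beta> 1 > 0\<close>. In the unclipped
  range \<open>\<bar>x\<bar> < phi \<beta> 1 < 1 / \<beta>\<close>, so \<open>\<beta> * x\<close>
  lies in the domain of \<open>artanh\<close>.\<close>

lemma phi_inv_pos_iff:
  assumes "\<beta> > 0"
  shows "phi_inv \<beta> x > 0 \<longleftrightarrow> x > 0"
proof -
  have "phi \<beta> 1 > 0" "phi \<beta> 1 < 1 / \<beta>"
    using assms abs_phi_less[of \<beta> 1] by (auto simp: phi_pos_iff)
  moreover have "artanh (\<beta> * x) > 0 \<longleftrightarrow> x > 0" if "\<bar>x\<bar> < 1 / \<beta>"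
    using that assms by (subst artanh_pos_iff) (auto simp: abs_mult field_simps zero_less_mult_iff)
  ultimately show ?thesis
    using assms unfolding phi_inv_def by (auto simp: zero_less_divide_iff)
qed

lemma is_game_map_phi:
  assumes "is_game P" "\<beta> \<ge> 1"
  shows "is_game (map_matrix (phi \<beta>) P)"
proof -
  have "\<bar>phi \<beta> x\<bar> \<le> 1" for x
  proof -
    have "1 / \<beta> \<le> 1" using assms(2) by simp
    then show ?thesis using abs_phi_less[of \<beta> x] assms(2) by linarith
  qed
  moreover have "phi \<beta> (- x) = - phi \<beta> x" for x by (simp add: phi_def)
  moreover have "map_matrix (phi \<beta>) P $ i $ j = (- transpose (map_matrix (phi \<beta>) P)) $ i $ j" for i j
    using is_gameD(1)[OF assms(1), of i j] \<open>phi \<beta> (- P $ i $ j) = - phi \<beta> (P $ i $ j)\<close>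
    by (simp add: transpose_def)
  then have "map_matrix (phi \<beta>) P = - transpose (map_matrix (phi \<beta>) P)"
    unfolding vec_eq_iff by blast
  ultimately show ?thesis
    unfolding is_game_def by (simp add: abs_le_iff minus_le_iff)
qed

section \<open>Extremal entries of a game\<close>

lemma P_max_ge: "P $ i $ j \<le> P_max P"
proof -
  have "finite {P $ i $ j | i j. True}"
    by (rule finite_subset[of _ "range (\<lambda>(i, j). P $ i $ j)"]) auto
  then show ?thesis unfolding P_max_def by (intro Max_ge) auto
qed

lemma
  assumes "P $ i0 $ j0 > 0"
  shows P_min_pos: "P_min P > 0" and P_min_le: "P $ i $ j > 0 \<Longrightarrow> P_min P \<le> P $ i $ j"
proof -
  have fin: "finite {P $ i $ j | i j. P $ i $ j > 0}"
    by (rule finite_subset[of _ "range (\<lambda>(i, j). P $ i $ j)"]) auto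
  then have "P_min P \<in> {P $ i $ j | i j. P $ i $ j > 0}"
    unfolding P_min_def using assms by (intro Min_in) auto
  then show "P_min P > 0" by auto
  show "P_min P \<le> P $ i $ j" if "P $ i $ j > 0"
    unfolding P_min_def using fin that by (intro Min_le) auto
qed

text \<open>Two distinct players and regularity provide a positive entry, so the minimum is over a
  nonempty set.\<close>

lemma game_P_min_P_max:
  fixes P :: "real^'n^'n"
  assumes "CARD('n) \<ge> 2" "is_game P" "regular_game P"
  shows "0 < P_min P" "P_min P \<le> P_max P" "P $ i $ j > 0 \<Longrightarrow> P_min P \<le> P $ i $ j"
proof -
  have "\<not> CARD('n) \<le> 1" using assms(1) by auto
  then obtain i0 j0 :: 'n where "i0 \<noteq> j0" using card_le_Suc0_iff_eq[of "UNIV :: 'n set"] by auto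
  then have "P $ i0 $ j0 \<noteq> 0" using assms(3) by (simp add: regular_game_def)
  then have "P $ i0 $ j0 > 0 \<or> P $ j0 $ i0 > 0"
    using is_gameD(1)[OF assms(2), of j0 i0] by linarith
  then obtain i1 j1 where pos: "P $ i1 $ j1 > 0" by blast
  show "0 < P_min P" by (rule P_min_pos[OF pos])
  show "P_min P \<le> P_max P" using P_min_le[OF pos pos] P_max_ge[of P i1 j1] by linarith
  show "P $ i $ j > 0 \<Longrightarrow> P_min P \<le> P $ i $ j" by (rule P_min_le[OF pos])
qed

section \<open>From ratio hypotheses to equivalence\<close>

text \<open>Used with \<open>c = n - 2\<close> and
  \<open>d = n - 2 + n * (n - 1) * \<alpha>\<close>. The strict inequality comes from
  \<open>c < d\<close>, so a non-strict ratio bound suffices, as is given for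
  \<open>\<beta>\<^sub>\<alpha>\<close>.\<close>

lemma ratio_gap:
  fixes a b c d n :: real
  assumes "b / a \<le> n / d" "0 < a" "0 < b" "c < d" "0 < d"
  shows "c * b < n * a"
proof -
  have "c * b < d * b" using assms by simp
  also have "\<dots> \<le> n * a" using assms by (simp add: field_simps)
  finally show ?thesis .
qed

lemma game_equiv_Elo_if_ratio:
  fixes P :: "real^'n^'n"
  assumes "CARD('n) \<ge> 2" and game: "is_game P" "regular_game P" "transitive_game P"
    and "real CARD('n) - 2 < d" "0 < d"
    and "P_max P < 1" "P_max P / P_min P \<le> real CARD('n) / d"
  shows "P \<sim>\<^sub>G Elo P"
proof -
  note bounds = game_P_min_P_max[OF assms(1) game(1,2)]
  have lt_1: "\<bar>P $ i $ j\<bar> < 1" for i j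
    using P_max_ge[of P i j] P_max_ge[of P j i] is_gameD(1)[OF game(1), of i j] assms(7) by linarith
  have gap: "(real CARD('n) - 2) * P_max P < real CARD('n) * P_min P"
    using assms(8) bounds(1,2) assms(5,6) by (intro ratio_gap[where d = d]) auto
  show ?thesis by (rule game_equiv_Elo[OF game lt_1 bounds(3) P_max_ge bounds(1) gap])
qed

text \<open>Here \<open>s\<close> stands for \<open>\<beta>\<^sub>\<alpha>\<close>. The factor
  \<open>1 / \<beta>\<close> cancels in the ratio of the transformed bounds, and
  \<open>1 \<le> \<beta>\<close> forces the transformed entries strictly inside (-1,1), where a
  minimizer exists.\<close>

lemma game_equiv_phi_Elo:
  fixes P :: "real^'n^'n"
  assumes "CARD('n) \<ge> 2" and game: "is_game P" "regular_game P" "transitive_game P"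
    and "real CARD('n) - 2 < d" "0 < d"
    and s: "0 < s" "tanh (s * P_max P) / tanh (s * P_min P) \<le> real CARD('n) / d"
    and "1 \<le> \<beta>" "s \<le> \<beta>"
  defines "Q \<equiv> map_matrix (phi \<beta>) P"
  shows "P \<sim>\<^sub>G Q" "Q \<sim>\<^sub>G Elo Q" "P \<sim>\<^sub>G map_matrix (phi_inv \<beta>) (Elo Q)"
proof -
  note bounds = game_P_min_P_max[OF assms(1) game(1,2)]
  have "\<beta> > 0" using assms(9) by simp
  show PQ: "P \<sim>\<^sub>G Q" using phi_pos_iff[OF \<open>\<beta> > 0\<close>] by (simp add: Q_def game_equiv_def)
  have Q_game: "is_game Q" unfolding Q_def using game(1) assms(9) by (rule is_game_map_phi)
  have Q_reg: "regular_game Q"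
    using game(2) \<open>\<beta> > 0\<close> by (simp add: regular_game_def Q_def phi_def)
  have Q_trans: "transitive_game Q"
    using game(3) PQ unfolding transitive_game_def game_equiv_def by blast
  have "tanh (\<beta> * P_max P) / tanh (\<beta> * P_min P) \<le> tanh (s * P_max P) / tanh (s * P_min P)"
    using bounds(1,2) s(1) assms(10) by (rule tanh_ratio_nonincreasing)
  then have "phi \<beta> (P_max P) / phi \<beta> (P_min P) \<le> real CARD('n) / d"
    using s(2) \<open>\<beta> > 0\<close> by (simp add: phi_def)
  then have gap: "(real CARD('n) - 2) * phi \<beta> (P_max P) < real CARD('n) * phi \<beta> (P_min P)"
    using bounds(1,2) \<open>\<beta> > 0\<close> assms(5,6) by (intro ratio_gap[where d = d]) (simp_all add: phi_pos_iff)
  have lt_1: "\<bar>Q $ i $ j\<bar> < 1" for i j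
  proof -
    have "1 / \<beta> \<le> 1" using assms(9) by simp
    then show ?thesis
      using abs_phi_less[OF \<open>\<beta> > 0\<close>, of "P $ i $ j"] unfolding Q_def nth_map_matrix by linarith
  qed
  show QE: "Q \<sim>\<^sub>G Elo Q"
  proof (rule game_equiv_Elo[OF Q_game Q_reg Q_trans lt_1 _ _ _ gap])
    show "phi \<beta> (P_min P) \<le> Q $ i $ j" if "Q $ i $ j > 0" for i j
      using that bounds(3) \<open>\<beta> > 0\<close> by (auto simp: Q_def phi_pos_iff intro: phi_mono)
    show "Q $ i $ j \<le> phi \<beta> (P_max P)" for i j
      using P_max_ge \<open>\<beta> > 0\<close> by (auto simp: Q_def intro: phi_mono)
    show "0 < phi \<beta> (P_min P)" using bounds(1) \<open>\<beta> > 0\<close> by (simp add: phi_pos_iff)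
  qed
  show "P \<sim>\<^sub>G map_matrix (phi_inv \<beta>) (Elo Q)"
    using PQ QE phi_inv_pos_iff[OF \<open>\<beta> > 0\<close>] by (simp add: game_equiv_def)
qed

text \<open>The scale \<open>1 / b * artanh y\<close> makes the denominator exactly
  \<open>y\<close>, while the numerator is below 1.\<close>

lemma tanh_ratio_artanh:
  fixes a b y :: real
  assumes "0 < b" "0 < y" "y < 1"
  shows "0 < 1 / b * artanh y" "tanh (1 / b * artanh y * a) / tanh (1 / b * artanh y * b) \<le> 1 / y"
proof -
  show "0 < 1 / b * artanh y" using assms by (simp add: artanh_pos_iff)
  have "tanh (1 / b * artanh y * b) = y" using assms by (simp add: tanh_artanh_real)
  then show "tanh (1 / b * artanh y * a) / tanh (1 / b * artanh y * b) \<le> 1 / y"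
    using assms tanh_real_lt_1[of "1 / b * artanh y * a"] by (simp add: divide_right_mono)
qed

theorem theorem1:
  fixes P :: "real^'n^'n" and \<alpha> n :: real
  defines "n \<equiv> real CARD('n)"
  assumes "CARD('n) \<ge> 2"
    and "is_game P" and "regular_game P" and "transitive_game P"
    and "0 < \<alpha>" and "\<alpha> < 2 / (n * (n - 1))"
  shows "(P_max P < x_root \<alpha> / (n - 1) \<and>
          P_max P / P_min P < n / (n - 2 + n * (n - 1) * \<alpha>)
          \<longrightarrow> P \<sim>\<^sub>G Elo P)
    \<and> (\<forall>\<beta>\<^sub>\<alpha>>0.
          tanh (\<beta>\<^sub>\<alpha> * P_max P) / tanh (\<beta>\<^sub>\<alpha> * P_min P) \<le> n / (n - 2 + n * (n - 1) * \<alpha>)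
          \<longrightarrow> (\<forall>\<beta>>max ((n - 1) / x_root \<alpha>) \<beta>\<^sub>\<alpha>.
                P \<sim>\<^sub>G map_matrix (phi \<beta>) P \<and>
                map_matrix (phi \<beta>) P \<sim>\<^sub>G Elo (map_matrix (phi \<beta>) P) \<and>
                P \<sim>\<^sub>G map_matrix (phi_inv \<beta>) (Elo (map_matrix (phi \<beta>) P))))
    \<and> (let \<beta>\<^sub>\<alpha> = 1 / P_min P * artanh ((n - 2) / n + (n - 1) * \<alpha>) in
          \<beta>\<^sub>\<alpha> > 0 \<and>
          tanh (\<beta>\<^sub>\<alpha> * P_max P) / tanh (\<beta>\<^sub>\<alpha> * P_min P) \<le> n / (n - 2 + n * (n - 1) * \<alpha>))"
proof -
  have n: "n \<ge> 2" using assms(2) by (simp add: n_def)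
  define d where "d = n - 2 + n * (n - 1) * \<alpha>"
  \<comment> \<open>The lower bound on \<alpha> gives \<open>n - 2 < d\<close>, the slack needed for
    the gap; the upper bound gives \<open>d < n\<close>, which puts \<open>d / n\<close> in the
    domain of \<open>artanh\<close>.\<close>
  have "n * (n - 1) * \<alpha> > 0" "n * (n - 1) * \<alpha> < 2"
    using n assms(6,7) by (simp_all add: field_simps)
  then have d: "n - 2 < d" "0 < d" "d < n" using n by (simp_all add: d_def)
  note root = x_root_bounds[OF assms(6)]
  have part1: "P \<sim>\<^sub>G Elo P" if "P_max P < x_root \<alpha> / (n - 1)" "P_max P / P_min P < n / d"
  proof (rule game_equiv_Elo_if_ratio[OF assms(2-5) d(1,2)[unfolded n_def]])
    have "x_root \<alpha> / (n - 1) \<le> x_root \<alpha>" using root n by (simp add: field_simps)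
    then show "P_max P < 1" using that(1) root by linarith
    show "P_max P / P_min P \<le> real CARD('n) / d" using that(2) by (simp add: n_def)
  qed
  have ge: "1 \<le> \<beta> \<and> s \<le> \<beta>" if "max ((n - 1) / x_root \<alpha>) s < \<beta>" for s \<beta>
  proof -
    \<comment> \<open>This follows from \<open>x_root \<alpha> < 1 \<le> n - 1\<close>.\<close>
    have "1 \<le> (n - 1) / x_root \<alpha>" using n root by (simp add: field_simps)
    then show ?thesis using that by linarith
  qed
  note part2 = game_equiv_phi_Elo[OF assms(2-5) d(1,2)[unfolded n_def], folded n_def]
  \<comment> \<open>The argument of \<open>artanh\<close> in the example is \<open>d / n\<close>,
    the reciprocal of the required ratio bound.\<close>
  have y: "(n - 2) / n + (n - 1) * \<alpha> = d / n" using n by (simp add: d_def field_simps)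
  have "0 < d / n" "d / n < 1" using d n by auto
  note part3 = tanh_ratio_artanh[OF game_P_min_P_max(1)[OF assms(2-4)] this]
  show ?thesis
    unfolding Let_def d_def[symmetric] y
    using part1 part2 ge part3(1) part3(2)[of "P_max P"] by auto
qed

end
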